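(* Let $(X,d)$ be a nonempty compact metric space. Then there exist a decreasing sequence $\{\epsilon_n\}_{n\in\mathbb{N}}$ of positive real numbers with $\lim_{n\to\infty}\epsilon_n=0$ and a sequence $\{A_n\}_{n\in\mathbb{N}}$, where each $A_n$ is an $\epsilon_n$-approximation of $X$, such that $(\mathcal{U}_{4\epsilon_n}(A_n),q_{n,n+1})$ is an inverse sequence of finite $T_0$ topological spaces and continuous maps, where $q_{n,n+1}:\mathcal{U}_{4\epsilon_{n+1}}(A_{n+1})\to\mathcal{U}_{4\epsilon_n}(A_n)$ is given by $q_{n,n+1}(C)=\bigcup_{x\in C}\mathcal{B}(x,\epsilon_n)\cap A_n$.
   Context: For $\epsilon>0$, a finite subset $A\subseteq X$ is an $\epsilon$-approximation of $X$ if for every $x\in X$ there is $a\in A$ with $d(x,a)<\epsilon$. $\mathcal{B}(x,\epsilon)$ is the open ball of center $x$ and radius $\epsilon$ in $X$. For an $\epsilon$-approximation $A$, $\mathcal{U}_{4\epsilon}(A)$ is the finite set of all nonempty $C\subseteq A$ with $\mathrm{diam}(C)<4\epsilon$, partially ordered by $C\leq D$ if and only if $D\subseteq C$, and given the $T_0$ topology whose open sets are the lower sets of $\leq$ (so the minimal open neighborhood of $C$ is $\{D : C\subseteq D\}$). An inverse sequence consists of spaces $X_n$ ($n\in\mathbb{N}=\{1,2,\dots\}$) and continuous maps $q_{n,n+1}:X_{n+1}\to X_n$. *)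

theory Defs
  imports "HOL-Analysis.Analysis"
begin

text \<open>Counterpart of \<^const>\<open>diameter\<close> for abstract metric spaces; as there, the diameter of
  the empty set is 0, and the value is meaningful only for bounded sets.\<close>

definition mdiameter :: "'a metric \<Rightarrow> 'a set \<Rightarrow> real" where
  "mdiameter X S = (if S = {} then 0 else SUP (x, y)\<in>S \<times> S. mdist X x y)"

definition eps_approximation :: "'a metric \<Rightarrow> real \<Rightarrow> 'a set \<Rightarrow> bool" where
  "eps_approximation X e A \<longleftrightarrow>
     e > 0 \<and> finite A \<and> A \<subseteq> mspace X \<and> (\<forall>x\<in>mspace X. \<exists>a\<in>A. mdist X x a < e)"

text \<open>The topology on the set \<open>P\<close>, ordered by \<open>le\<close>, whose open sets are the lower sets.\<close>

definition lower_set_topology :: "('b \<Rightarrow> 'b \<Rightarrow> bool) \<Rightarrow> 'b set \<Rightarrow> 'b topology" where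
  "lower_set_topology le P =
     topology (\<lambda>U. U \<subseteq> P \<and> (\<forall>y\<in>U. \<forall>x\<in>P. le x y \<longrightarrow> x \<in> U))"

lemma istopology_lower_sets: "istopology (\<lambda>U. U \<subseteq> P \<and> (\<forall>y\<in>U. \<forall>x\<in>P. le x y \<longrightarrow> x \<in> U))"
  unfolding istopology_def by blast

lemma openin_lower_set_topology:
  "openin (lower_set_topology le P) U \<longleftrightarrow> U \<subseteq> P \<and> (\<forall>y\<in>U. \<forall>x\<in>P. le x y \<longrightarrow> x \<in> U)"
  unfolding lower_set_topology_def by (subst topology_inverse') (rule istopology_lower_sets, rule refl)

lemma topspace_lower_set_topology [simp]: "topspace (lower_set_topology le P) = P"
  unfolding topspace_def openin_lower_set_topology by blast

text \<open>The points of \<open>\<U>\<^sub>r(A)\<close>; the order on them is reverse inclusion.\<close>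

definition small_subsets :: "'a metric \<Rightarrow> real \<Rightarrow> 'a set \<Rightarrow> 'a set set" where
  "small_subsets X r A = {C. C \<subseteq> A \<and> C \<noteq> {} \<and> mdiameter X C < r}"

definition small_subsets_space :: "'a metric \<Rightarrow> real \<Rightarrow> 'a set \<Rightarrow> 'a set topology" where
  "small_subsets_space X r A = lower_set_topology (\<lambda>C D. D \<subseteq> C) (small_subsets X r A)"

text \<open>\<open>q n\<close> is the map from the \<open>(n+1)\<close>-st space to the \<open>n\<close>-th; note that
  \<^const>\<open>continuous_map\<close> includes that it sends points of the one to points of the other.\<close>

definition inverse_sequence :: "(nat \<Rightarrow> 'b topology) \<Rightarrow> (nat \<Rightarrow> 'b \<Rightarrow> 'b) \<Rightarrow> bool" where
  "inverse_sequence S q \<longleftrightarrow> (\<forall>n. continuous_map (S (Suc n)) (S n) (q n))"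

end

theory Submission
  imports Defs
begin

text \<open>Compactness gives total boundedness, hence a finite approximation at every scale, and
  these can be chosen independently of each other. The metric content is that the maps land in the
  right space (\<open>ball_trace_in_small_subsets\<close>): points of the image of \<open>C\<close>
  lie within \<epsilon> of points of \<open>C\<close>, so halving \<epsilon> at each step leaves
  room for the triangle inequality. Continuity is then pure order theory: a union over
  \<open>C\<close> grows with \<open>C\<close>, and monotone maps are continuous for lower-set
  topologies. The T0 property is antisymmetry of inclusion.\<close>

text \<open>On a finite nonempty set the supremum is attained, so the strict bound passes between
  the diameter and the pairs. Positivity of \<open>r\<close> covers the empty set, whose diameter is
  0.\<close>

lemma mdiameter_less_iff:
  assumes "finite C" and "0 < r"
  shows "mdiameter X C < r \<longleftrightarrow> (\<forall>x\<in>C. \<forall>y\<in>C. mdist X x y < r)"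
proof (cases "C = {}")
  case False
  have "mdiameter X C = Max ((\<lambda>(x, y). mdist X x y) ` (C \<times> C))"
    using assms False by (simp add: mdiameter_def cSup_eq_Max)
  then show ?thesis
    using assms False by auto
qed (use assms in \<open>simp add: mdiameter_def\<close>)

text \<open>The preimage of a lower set under a monotone map is a lower set.\<close>

lemma continuous_map_lower_set_topology:
  assumes "f \<in> P \<rightarrow> Q"
    and "\<And>x y. x \<in> P \<Longrightarrow> y \<in> P \<Longrightarrow> le x y \<Longrightarrow> le' (f x) (f y)"
  shows "continuous_map (lower_set_topology le P) (lower_set_topology le' Q) f"
  unfolding continuous_map_def topspace_lower_set_topology openin_lower_set_topology
proof (intro conjI allI impI assms(1))
  fix U
  assume "U \<subseteq> Q \<and> (\<forall>y\<in>U. \<forall>x\<in>Q. le' x y \<longrightarrow> x \<in> U)"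
  then show "{x \<in> P. f x \<in> U} \<subseteq> P"
    and "\<forall>y\<in>{x \<in> P. f x \<in> U}. \<forall>x\<in>P. le x y \<longrightarrow> x \<in> {x \<in> P. f x \<in> U}"
    using assms by (auto simp: Pi_iff)
qed

lemma t0_space_lower_set_topology:
  assumes refl: "\<And>x. x \<in> P \<Longrightarrow> le x x"
    and antisym: "\<And>x y. x \<in> P \<Longrightarrow> y \<in> P \<Longrightarrow> le x y \<Longrightarrow> le y x \<Longrightarrow> x = y"
    and trans: "\<And>x y z. x \<in> P \<Longrightarrow> y \<in> P \<Longrightarrow> z \<in> P \<Longrightarrow> le x y \<Longrightarrow> le y z \<Longrightarrow> le x z"
  shows "t0_space (lower_set_topology le P)"
  unfolding t0_space_def topspace_lower_set_topology
proof (intro ballI impI)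
  fix x y
  assume xy: "x \<in> P" "y \<in> P" "x \<noteq> y"
  \<comment> \<open>Transitivity makes the principal down-set of \<open>w\<close> open; by
    reflexivity it contains \<open>w\<close>.\<close>
  have down_open: "openin (lower_set_topology le P) {z \<in> P. le z w}" if "w \<in> P" for w
    unfolding openin_lower_set_topology using trans that by blast
  show "\<exists>U. openin (lower_set_topology le P) U \<and> (x \<notin> U) = (y \<in> U)"
  proof (cases "le x y")
    \<comment> \<open>Antisymmetry keeps \<open>y\<close> out of the down-set of \<open>x\<close>.
      In the other case \<open>x\<close> is already outside the down-set of
      \<open>y\<close>.\<close>
    case True
    then show ?thesis
      using down_open[OF xy(1)] refl antisym xy by (intro exI[of _ "{z \<in> P. le z x}"]) auto
  next
    case False
    then show ?thesis
      using down_open[OF xy(2)] refl xy by (intro exI[of _ "{z \<in> P. le z y}"]) auto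
  qed
qed

lemma ex_eps_approximation:
  assumes "compact_space (mtopology_of X)" and "e > 0"
  shows "\<exists>A. eps_approximation X e A"
proof -
  interpret Metric_space "mspace X" "mdist X"
    by (rule Metric_space_mspace_mdist)
  have "compactin mtopology (mspace X)"
    using assms(1) by (simp add: compact_space_def mtopology_of_def)
  then obtain A where A: "finite A" "A \<subseteq> mspace X" "mspace X \<subseteq> (\<Union>x\<in>A. mball x e)"
    using assms(2) compactin_imp_mtotally_bounded unfolding mtotally_bounded_def by meson
  have "\<exists>a\<in>A. mdist X x a < e" if "x \<in> mspace X" for x
    using A(3) that by (fastforce simp: commute[of x])
  then show ?thesis
    using A assms(2) unfolding eps_approximation_def by blast
qed

text \<open>This makes the bonding maps well defined. The factor 4 splits as 2 + 2: two ball radii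
  \<open>e\<close>, plus \<open>4 * e'\<close>, which is at most \<open>2 * e\<close>.\<close>

lemma ball_trace_in_small_subsets:
  assumes A: "eps_approximation X e A" and B: "eps_approximation X e' B"
    and ee': "2 * e' \<le> e" and C: "C \<in> small_subsets X (4 * e') B"
  shows "(\<Union>x\<in>C. mball_of X x e \<inter> A) \<in> small_subsets X (4 * e) A" (is "?D \<in> _")
proof -
  interpret Metric_space "mspace X" "mdist X"
    by (rule Metric_space_mspace_mdist)
  have pos: "e > 0" "e' > 0" and fin: "finite A" "finite B" and sub: "B \<subseteq> mspace X"
    using A B by (auto simp: eps_approximation_def)
  have CB: "C \<subseteq> B" "C \<noteq> {}" and "mdiameter X C < 4 * e'"
    using C by (auto simp: small_subsets_def)
  moreover have "finite C"
    using CB fin finite_subset by blast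
  ultimately have close: "mdist X x y < 4 * e'" if "x \<in> C" "y \<in> C" for x y
    using that pos by (simp add: mdiameter_less_iff)
  have "mdist X a b < 4 * e" if ab: "a \<in> ?D" "b \<in> ?D" for a b
  proof -
    obtain x y where x: "x \<in> C" "x \<in> mspace X" "a \<in> mspace X" "mdist X x a < e"
      and y: "y \<in> C" "y \<in> mspace X" "b \<in> mspace X" "mdist X y b < e"
      using ab by auto
    \<comment> \<open>The path from \<open>a\<close> to \<open>b\<close> runs through the centers
      \<open>x\<close> and \<open>y\<close> in \<open>C\<close>.\<close>
    have "mdist X a b \<le> mdist X x a + mdist X x y + mdist X y b"
      using triangle[of a x b] triangle[of x y b] x y commute[of a x] by linarith
    then show ?thesis
      using x y close[of x y] ee' by linarith
  qed
  moreover have "finite ?D"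
    using fin by (auto intro: finite_subset[of _ A])
  ultimately have "mdiameter X ?D < 4 * e"
    using pos by (simp add: mdiameter_less_iff)
  \<comment> \<open>Any point of \<open>C\<close> has a point of \<open>A\<close> within
    \<open>e\<close>, since \<open>A\<close> is an \<open>e\<close>-approximation.\<close>
  moreover have "?D \<noteq> {}"
  proof -
    obtain x where x: "x \<in> C" "x \<in> mspace X"
      using CB sub by blast
    then obtain a where "a \<in> A" "mdist X x a < e"
      using A by (auto simp: eps_approximation_def)
    with x have "a \<in> mball_of X x e \<inter> A"
      using A by (auto simp: eps_approximation_def mball_of_def)
    with x show ?thesis by blast
  qed
  ultimately show ?thesis
    by (auto simp: small_subsets_def)
qed

theorem theorem2p3:
  fixes X :: "'a metric"
  assumes "mspace X \<noteq> {}"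
    and "compact_space (mtopology_of X)"
  shows "\<exists>(\<epsilon> :: nat \<Rightarrow> real) (A :: nat \<Rightarrow> 'a set).
           (\<forall>n. \<epsilon> n > 0) \<and> (\<forall>n. \<epsilon> (Suc n) < \<epsilon> n) \<and> \<epsilon> \<longlonglongrightarrow> 0 \<and>
           (\<forall>n. eps_approximation X (\<epsilon> n) (A n)) \<and>
           (\<forall>n. finite (topspace (small_subsets_space X (4 * \<epsilon> n) (A n)))) \<and>
           (\<forall>n. t0_space (small_subsets_space X (4 * \<epsilon> n) (A n))) \<and>
           inverse_sequence (\<lambda>n. small_subsets_space X (4 * \<epsilon> n) (A n))
             (\<lambda>n C. \<Union>x\<in>C. mball_of X x (\<epsilon> n) \<inter> A n)"
proof -
  \<comment> \<open>If \<open>diam C < 4\<epsilon>\<^sub>n\<^sub>+\<^sub>1\<close>, the image of \<open>C\<close> has diameter below \<open>2\<epsilon>\<^sub>n + 4\<epsilon>\<^sub>n\<^sub>+\<^sub>1\<close>,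
    so halving \<open>\<epsilon>\<close> at each step is enough.\<close>
  define \<epsilon> :: "nat \<Rightarrow> real" where "\<epsilon> n = (1/2) ^ n" for n
  have pos: "\<epsilon> n > 0" for n
    by (simp add: \<epsilon>_def)
  have half: "2 * \<epsilon> (Suc n) = \<epsilon> n" for n
    by (simp add: \<epsilon>_def)
  have lim: "\<epsilon> \<longlonglongrightarrow> 0"
    unfolding \<epsilon>_def by (rule LIMSEQ_power_zero) simp
  obtain A where A: "\<And>n. eps_approximation X (\<epsilon> n) (A n)"
    using ex_eps_approximation[OF assms(2) pos] by metis
  have "finite (topspace (small_subsets_space X (4 * \<epsilon> n) (A n)))" for n
  proof -
    have "small_subsets X (4 * \<epsilon> n) (A n) \<subseteq> Pow (A n)"
      by (auto simp: small_subsets_def)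
    moreover have "finite (A n)"
      using A by (simp add: eps_approximation_def)
    ultimately show ?thesis
      by (simp add: small_subsets_space_def finite_subset)
  qed
  moreover have "t0_space (small_subsets_space X (4 * \<epsilon> n) (A n))" for n
    unfolding small_subsets_space_def by (rule t0_space_lower_set_topology) auto
  moreover have "inverse_sequence (\<lambda>n. small_subsets_space X (4 * \<epsilon> n) (A n))
      (\<lambda>n C. \<Union>x\<in>C. mball_of X x (\<epsilon> n) \<inter> A n)"
    unfolding inverse_sequence_def small_subsets_space_def
  proof (intro allI continuous_map_lower_set_topology)
    show "(\<lambda>C. \<Union>x\<in>C. mball_of X x (\<epsilon> n) \<inter> A n)
        \<in> small_subsets X (4 * \<epsilon> (Suc n)) (A (Suc n)) \<rightarrow> small_subsets X (4 * \<epsilon> n) (A n)" for n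
      \<comment> \<open>The condition on the two scales holds with equality, by
        \<open>half\<close>.\<close>
      by (intro Pi_I ball_trace_in_small_subsets[OF A A]) (simp_all only: half order_refl)
  \<comment> \<open>What remains is monotonicity: a larger \<open>C\<close> has a larger
    union.\<close>
  qed blast
  moreover have "\<epsilon> (Suc n) < \<epsilon> n" for n
    using half[of n] pos[of "Suc n"] by linarith
  ultimately show ?thesis
    using pos lim A by (intro exI[of _ \<epsilon>] exI[of _ A] conjI allI)
qed

end
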